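(* Let $(q_n)_{n\ge 0}$ be a $[0,1]$-valued sequence such that $n(1-q_n)/\log n\to\infty$. Then for any $\varepsilon>0$ and $\lambda>0$, $$\mathbb P\left(\left|\frac{h(T_{n,q_n})}{n(1-q_n)}-1\right|>\varepsilon\right)=O\left(\frac1{n^\lambda}\right)\qquad\text{as } n\to\infty.$$
   Context: Let $T_\infty=\bigcup_{k\ge 0}\{\overline 0,\overline 1\}^k$ be the complete infinite rooted binary tree: nodes are finite strings over $\{\overline 0,\overline 1\}$, the root is the empty string $\varnothing$, the node $u$ has left child $u\overline 0$ and right child $u\overline 1$, and $|u|$ (the depth of $u$) is the length of $u$. For a set $V\subset T_\infty$ write $uV=\{uv:v\in V\}$. A tree is a connected subset of $T_\infty$; its height is $h(T)=\sup_{u\in T}|u|-\inf_{u\in T}|u|$. For a finite sequence $f=(f(1),\dots,f(n))$ of distinct positive integers, the binary search tree $T\langle f\rangle\subset T_\infty$ is defined inductively: $T\langle f\rangle=\emptyset$ if $n=0$; otherwise $T\langle f\rangle=\{\varnothing\}\cup \overline 0\,T\langle f^-\rangle\cup\overline 1\,T\langle f^+\rangle$, where $f^-$ (resp. $f^+$) is the subsequence of terms $f(i)<f(1)$ (resp. $f(i)>f(1)$), in the same order as in $f$. For $n\ge 0$ and $q\in[0,1]$, the Mallows distribution $\pi_{n,q}$ on the symmetric group $\mathcal S_n$ gives each $\sigma$ probability proportional to $q^{\mathrm{Inv}(\sigma)}$, where $\mathrm{Inv}(\sigma)=|\{i<j:\sigma(i)>\sigma(j)\}|$ (with $0^0=1$,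 so that $\pi_{n,0}$ is concentrated on the identity). $T_{n,q}$ denotes a random tree distributed as $T\langle\sigma\rangle$ with $\sigma\sim\pi_{n,q}$. *)

theory Defs
  imports
    "HOL-Probability.Probability"
    "HOL-Combinatorics.Permutations"
    "HOL-Library.Landau_Symbols"
begin

text \<open>
  Nodes of the infinite binary tree are finite binary strings, with \<open>False\<close> for the letter 0 and
  \<open>True\<close> for the letter 1, so the type \<open>node set\<close> consists of the subsets of the whole tree. The
  root is \<open>[]\<close>, the children of \<open>u\<close> are \<open>u @ [False]\<close> and \<open>u @ [True]\<close>, and the depth of \<open>u\<close> is
  \<open>length u\<close>.
\<close>

type_synonym node = "bool list"

definition prepend :: "node \<Rightarrow> node set \<Rightarrow> node set" where
  "prepend u V = {u @ v |v. v \<in> V}"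

text \<open>
  The supremum and infimum are those of the reals, so this is the intended height only for a
  nonempty set of bounded depth; this covers the nonempty finite trees. The value at the empty tree
  is unspecified.
\<close>

definition tree_height :: "node set \<Rightarrow> real" where
  "tree_height T = (SUP u\<in>T. real (length u)) - (INF u\<in>T. real (length u))"

fun bst :: "nat list \<Rightarrow> node set" where
  "bst [] = {}"
| "bst (x # xs) =
     {[]} \<union> prepend [False] (bst (filter (\<lambda>y. y < x) xs))
          \<union> prepend [True] (bst (filter (\<lambda>y. y > x) xs))"

lemma finite_bst: "finite (bst xs)"
  by (induction xs rule: bst.induct) (auto simp: prepend_def)

definition inversions :: "nat \<Rightarrow> (nat \<Rightarrow> nat) \<Rightarrow> nat" where
  "inversions n \<sigma> = card {(i, j). i \<in> {1..n} \<and> j \<in> {1..n} \<and> i < j \<and> \<sigma> i > \<sigma> j}"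

definition mallows_normalizer :: "nat \<Rightarrow> real \<Rightarrow> real" where
  "mallows_normalizer n q = (\<Sum>\<sigma> | \<sigma> permutes {1..n}. q ^ inversions n \<sigma>)"

text \<open>
  The symmetric group is the set of functions permuting \<open>{1..n}\<close>. The convention \<open>0 ^ 0 = 1\<close> of the
  library makes the distribution for \<open>q = 0\<close> the point mass at the identity. Meaningful for
  \<open>q \<ge> 0\<close> only, see \<open>pmf_mallows\<close>.
\<close>

definition mallows :: "nat \<Rightarrow> real \<Rightarrow> (nat \<Rightarrow> nat) pmf" where
  "mallows n q = embed_pmf
     (\<lambda>\<sigma>. if \<sigma> permutes {1..n} then q ^ inversions n \<sigma> / mallows_normalizer n q else 0)"

lemma inversions_id: "inversions n id = 0"
proof -
  have "{(i, j). i \<in> {1..n} \<and> j \<in> {1..n} \<and> i < j \<and> id i > (id j :: nat)} = {}" by auto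
  then show ?thesis unfolding inversions_def by (metis card.empty)
qed

lemma mallows_normalizer_pos:
  assumes "q \<ge> 0"
  shows "mallows_normalizer n q > 0"
  unfolding mallows_normalizer_def
proof (rule sum_pos2)
  show "finite {\<sigma>. \<sigma> permutes {1..n}}" by (simp add: finite_permutations)
  show "id \<in> {\<sigma>. \<sigma> permutes {1..n}}" by (simp add: permutes_id)
  show "0 < q ^ inversions n id" by (simp add: inversions_id)
qed (use assms in auto)

lemma pmf_mallows:
  assumes "q \<ge> 0"
  shows "pmf (mallows n q) \<sigma> =
    (if \<sigma> permutes {1..n} then q ^ inversions n \<sigma> / mallows_normalizer n q else 0)"
  unfolding mallows_def
proof (rule pmf_embed_pmf)
  let ?f = "\<lambda>\<sigma>. if \<sigma> permutes {1..n} then q ^ inversions n \<sigma> / mallows_normalizer n q else 0"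
  let ?S = "{\<sigma>. \<sigma> permutes {1..n}}"
  note pos = mallows_normalizer_pos[OF assms, of n]
  have fin: "finite ?S" by (simp add: finite_permutations)
  show nn: "0 \<le> ?f \<sigma>" for \<sigma> using assms pos by auto
  have "(\<integral>\<^sup>+\<sigma>. ennreal (?f \<sigma>) \<partial>count_space UNIV) = (\<Sum>\<sigma>\<in>?S. ennreal (?f \<sigma>))"
    by (rule nn_integral_count_space') (use fin in auto)
  also have "\<dots> = ennreal (\<Sum>\<sigma>\<in>?S. ?f \<sigma>)"
    by (rule sum_ennreal) (rule nn)
  also have "(\<Sum>\<sigma>\<in>?S. ?f \<sigma>) = (\<Sum>\<sigma>\<in>?S. q ^ inversions n \<sigma> / mallows_normalizer n q)"
    by (rule sum.cong) auto
  also have "\<dots> = mallows_normalizer n q / mallows_normalizer n q"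
    by (subst sum_divide_distrib[symmetric]) (simp only: mallows_normalizer_def)
  finally show "(\<integral>\<^sup>+\<sigma>. ennreal (?f \<sigma>) \<partial>count_space UNIV) = 1" using pos by simp
qed

definition mallows_tree :: "nat \<Rightarrow> real \<Rightarrow> node set pmf" where
  "mallows_tree n q = map_pmf (\<lambda>\<sigma>. bst (map \<sigma> [1..<n + 1])) (mallows n q)"

end

theory Submission
  imports Defs "HOL-Combinatorics.Multiset_Permutations"
begin

text \<open>
  Write \<open>x = n * (1 - q)\<close>. The depth of the node with label \<open>i\<close> is the number of its ancestors, and the
  ancestors are the labels \<open>j\<close> that come first in the word among all letters between \<open>i\<close> and \<open>j\<close>
  (\<open>depths_bst\<close>). Split them into the low ancestors \<open>j < i\<close> and the high ancestors \<open>j > i\<close>.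

  A Mallows word can be built by inserting letters one by one such that each is the smallest or the
  largest so far. The number of inversions created then depends on the position of the new letter only,
  so the positions are independent with truncated geometric laws. Starting from \<open>i\<close> and going down,
  the letter that makes the word \<open>m\<close> long becomes an ancestor of \<open>i\<close> if and only if it is put in front,
  which has probability \<open>1 / [m]\<close> with \<open>[m] = 1 + q + \<dots> + q ^ (m - 1)\<close>; going up instead, the
  probability is \<open>q ^ (m - 1) / [m]\<close>. Hence each of the two numbers of ancestors is a sum of
  independent indicators (\<open>mallows_mean_low_ancestors\<close>, \<open>mallows_mean_high_ancestors\<close>).

  Since \<open>1 - q \<le> 1 / [m] \<le> (1 - q) + 1 / m\<close> and \<open>q ^ (m - 1) / [m] \<le> 1 / m\<close>, the mean number of low
  ancestors is at most \<open>x + ln n\<close>, and at least \<open>x - 1\<close> for \<open>i = n\<close>, while the mean number of high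
  ancestors is at most \<open>ln n\<close>. Chernoff bounds and a union bound over \<open>i\<close> show that a relative
  deviation of the height from \<open>x\<close> has probability at most \<open>n powr C * exp (- c * x)\<close> up to a constant
  factor (\<open>mallows_height_upper_tail\<close>, \<open>mallows_height_lower_tail\<close>). This beats every power of \<open>n\<close>
  because \<open>x\<close> grows faster than \<open>ln n\<close>.
\<close>

section \<open>Inversions of words\<close>

fun list_inversions :: "nat list \<Rightarrow> nat" where
  "list_inversions [] = 0"
| "list_inversions (x # xs) = length (filter (\<lambda>y. y < x) xs) + list_inversions xs"

lemma list_inversions_insert_min:
  assumes "\<And>y. y \<in> set (u @ v) \<Longrightarrow> x < y"
  shows "list_inversions (u @ x # v) = length u + list_inversions (u @ v)"
  using assms
proof (induction u)
  case Nil
  have "\<not> y < x" if "y \<in> set v" for y using Nil[of y] that by simp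
  then show ?case by simp
qed auto

lemma list_inversions_insert_max:
  assumes "\<And>y. y \<in> set (u @ v) \<Longrightarrow> y < x"
  shows "list_inversions (u @ x # v) = length v + list_inversions (u @ v)"
  using assms
proof (induction u)
  case (Cons a u)
  then have "a < x" by simp
  then have "\<not> x < a" by simp
  with Cons \<open>a < x\<close> show ?case by simp
qed simp

lemma list_inversions_snoc:
  "list_inversions (xs @ [y]) = list_inversions xs + length (filter (\<lambda>x. y < x) xs)"
  by (induction xs) auto

lemma inversions_eq_list_inversions:
  "inversions n \<sigma> = list_inversions (map \<sigma> [1..<n + 1])"
proof (induction n)
  case 0
  then show ?case by (simp add: inversions_def)
next
  case (Suc n)
  let ?I = "\<lambda>n. {(i, j). i \<in> {1..n} \<and> j \<in> {1..n} \<and> i < j \<and> \<sigma> i > \<sigma> j}"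
  let ?N = "{i \<in> {1..n}. \<sigma> (Suc n) < \<sigma> i}"
  have fin: "finite (?I n)"
    by (rule finite_subset[of _ "{1..n} \<times> {1..n}"]) auto
  have "?I (Suc n) = ?I n \<union> (\<lambda>i. (i, Suc n)) ` ?N"
    by (auto simp: le_Suc_eq)
  then have "inversions (Suc n) \<sigma> = inversions n \<sigma> + card ((\<lambda>i. (i, Suc n)) ` ?N)"
    unfolding inversions_def using fin by (subst card_Un_disjoint[symmetric]) auto
  also have "card ((\<lambda>i. (i, Suc n)) ` ?N) = card ?N"
    by (rule card_image) (auto simp: inj_on_def)
  also have "?N = set (filter (\<lambda>i. \<sigma> (Suc n) < \<sigma> i) [1..<n + 1])"
    by auto
  also have "card \<dots> = length (filter (\<lambda>i. \<sigma> (Suc n) < \<sigma> i) [1..<n + 1])"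
    by (rule distinct_card) simp
  also have "\<dots> = length (filter (\<lambda>y. \<sigma> (Suc n) < y) (map \<sigma> [1..<n + 1]))"
    by (simp add: filter_map comp_def)
  finally show ?case
    using Suc by (simp add: list_inversions_snoc)
qed

section \<open>Mallows means and insertion of extremal values\<close>

definition insert_at :: "'a \<Rightarrow> nat \<Rightarrow> 'a list \<Rightarrow> 'a list" where
  "insert_at x r w = take r w @ x # drop r w"

text \<open>
  A word on \<open>insert x S\<close> is a word on \<open>S\<close> together with the position of \<open>x\<close>; deleting the
  letter \<open>x\<close> and remembering where it stood is the inverse map.
\<close>

lemma sum_permutations_of_set_insert:
  assumes "finite S" and x: "x \<notin> S"
  shows "(\<Sum>w\<in>permutations_of_set (insert x S). F w) =
    (\<Sum>w\<in>permutations_of_set S. \<Sum>r\<le>card S. F (insert_at x r w))"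
proof -
  have len: "length w = card S" if "w \<in> permutations_of_set S" for w
    using that by (rule length_finite_permutations_of_set)
  have notin: "x \<notin> set w" if "w \<in> permutations_of_set S" for w
    using that x by (auto dest: permutations_of_setD)
  have "(\<Sum>w\<in>permutations_of_set (insert x S). F w) =
    (\<Sum>(w, r)\<in>permutations_of_set S \<times> {..card S}. F (insert_at x r w))"
  proof (rule sum.reindex_bij_witness[where
        i = "\<lambda>(w, r). insert_at x r w" and
        j = "\<lambda>w. (remove1 x w, length (takeWhile (\<lambda>y. y \<noteq> x) w))"])
    fix w assume w: "w \<in> permutations_of_set (insert x S)"
    then have d: "distinct w" "set w = insert x S" by (auto dest: permutations_of_setD)
    then obtain u v where uv: "w = u @ x # v" "x \<notin> set u"
      by (metis insertI1 split_list_first)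
    then have *: "takeWhile (\<lambda>y. y \<noteq> x) w = u" "remove1 x w = u @ v"
      by (auto simp: takeWhile_append remove1_append)
    show "(case (remove1 x w, length (takeWhile (\<lambda>y. y \<noteq> x) w)) of (w, r) \<Rightarrow> insert_at x r w) = w"
      by (simp only: * prod.case) (simp add: insert_at_def uv)
    have "u @ v \<in> permutations_of_set S"
      using d uv x by (auto simp: permutations_of_set_def)
    moreover from len[OF this] have "length u \<le> card S" by simp
    ultimately show "(remove1 x w, length (takeWhile (\<lambda>y. y \<noteq> x) w)) \<in> permutations_of_set S \<times> {..card S}"
      by (simp add: *)
    show "(case (remove1 x w, length (takeWhile (\<lambda>y. y \<noteq> x) w)) of (w, r) \<Rightarrow> F (insert_at x r w)) = F w"
      by (simp only: * prod.case) (simp add: insert_at_def uv)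
  next
    fix p assume "p \<in> permutations_of_set S \<times> {..card S}"
    then obtain w r where p: "p = (w, r)" "w \<in> permutations_of_set S" "r \<le> card S" by auto
    have w: "distinct w" "set w = S" using p by (auto dest: permutations_of_setD)
    have nt: "x \<notin> set (take r w)" using notin[OF p(2)] by (auto dest: in_set_takeD)
    have 1: "takeWhile (\<lambda>y. y \<noteq> x) (insert_at x r w) = take r w"
      using nt unfolding insert_at_def by (subst takeWhile_append2) auto
    have 2: "remove1 x (insert_at x r w) = w"
      using nt by (simp add: insert_at_def remove1_append)
    show "(remove1 x (case p of (w, r) \<Rightarrow> insert_at x r w),
      length (takeWhile (\<lambda>y. y \<noteq> x) (case p of (w, r) \<Rightarrow> insert_at x r w))) = p"
      using p len[OF p(2)] by (simp add: 1 2)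
    have "set (insert_at x r w) = insert x (set (take r w @ drop r w))"
      by (auto simp: insert_at_def simp del: append_take_drop_id)
    then have "set (insert_at x r w) = insert x S" using w by simp
    moreover have "distinct (insert_at x r w)"
      using w notin[OF p(2)] by (auto simp: insert_at_def set_take_disj_set_drop_if_distinct
          dest: in_set_takeD in_set_dropD)
    ultimately show "(case p of (w, r) \<Rightarrow> insert_at x r w) \<in> permutations_of_set (insert x S)"
      by (simp add: p permutations_of_set_def)
  qed
  then show ?thesis by (simp add: sum.cartesian_product)
qed

text \<open>
  The expectation of \<open>F\<close> under the law on the words with letter set \<open>S\<close> that weights a word by
  \<open>q\<close> to the number of its inversions. General letter sets are allowed because the generating
  functions below are computed by adding one letter at a time.
\<close>

definition mallows_mean :: "real \<Rightarrow> nat set \<Rightarrow> (nat list \<Rightarrow> real) \<Rightarrow> real" where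
  "mallows_mean q S F =
     (\<Sum>w\<in>permutations_of_set S. q ^ list_inversions w * F w) /
     (\<Sum>w\<in>permutations_of_set S. q ^ list_inversions w)"

text \<open>
  The \<open>q\<close>-analogue \<open>(1 - q ^ m) / (1 - q)\<close> of \<open>m\<close>, in a form that covers \<open>q = 1\<close>. It is the
  generating function of the number of inversions created when an extremal letter is inserted
  into a word of length \<open>m - 1\<close>.
\<close>

definition q_number :: "real \<Rightarrow> nat \<Rightarrow> real" where
  "q_number q m = (\<Sum>r<m. q ^ r)"

text \<open>
  A smallest letter inserted at position \<open>r\<close> creates exactly \<open>r\<close> inversions, whatever the rest of
  the word is. Hence its position is independent of the rest of the word, with a truncated
  geometric law, and a statistic that reacts to it by a factor \<open>g r\<close> gains the
  mean of \<open>g\<close> as a factor.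
\<close>

lemma mallows_mean_insert_min:
  assumes S: "finite S" "\<And>y. y \<in> S \<Longrightarrow> x < y"
    and F: "\<And>w r. w \<in> permutations_of_set S \<Longrightarrow> r \<le> card S \<Longrightarrow> F (insert_at x r w) = g r * F w"
  shows "mallows_mean q (insert x S) F =
    (\<Sum>r\<le>card S. q ^ r * g r) / q_number q (card S + 1) * mallows_mean q S F"
proof -
  have x: "x \<notin> S" using S by auto
  have inv: "list_inversions (insert_at x r w) = r + list_inversions w"
    if "w \<in> permutations_of_set S" "r \<le> card S" for w r
  proof -
    have "set w = S" "length w = card S" using that
      by (auto dest: permutations_of_setD length_finite_permutations_of_set)
    then show ?thesis using that S list_inversions_insert_min[of "take r w" "drop r w" x]
      by (simp add: insert_at_def)
  qed
  have "(\<Sum>w\<in>permutations_of_set (insert x S). q ^ list_inversions w * G w) =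
      (\<Sum>r\<le>card S. q ^ r * h r) * (\<Sum>w\<in>permutations_of_set S. q ^ list_inversions w * G w)"
    if "\<And>w r. w \<in> permutations_of_set S \<Longrightarrow> r \<le> card S \<Longrightarrow> G (insert_at x r w) = h r * G w" for G h
    unfolding sum_permutations_of_set_insert[OF S(1) x]
    by (subst sum_product, subst sum.swap, intro sum.cong refl)
      (auto simp: inv that power_add)
  from this[OF F] this[of "\<lambda>_. 1" "\<lambda>_. 1"] show ?thesis
    by (simp add: mallows_mean_def q_number_def lessThan_Suc_atMost)
qed

lemma sum_atMost_diff: "(\<Sum>r\<le>k. q ^ (k - r)) = q_number q (k + 1)"
  unfolding q_number_def Suc_eq_plus1[symmetric] lessThan_Suc_atMost
  by (rule sum.nat_diff_reindex[of _ "Suc k", simplified lessThan_Suc_atMost, simplified])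

text \<open>
  A largest letter inserted at position \<open>r\<close> forms an inversion with every letter behind it, which
  reverses the truncated geometric law.
\<close>

lemma mallows_mean_insert_max:
  assumes S: "finite S" "\<And>y. y \<in> S \<Longrightarrow> y < x"
    and F: "\<And>w r. w \<in> permutations_of_set S \<Longrightarrow> r \<le> card S \<Longrightarrow> F (insert_at x r w) = g r * F w"
  shows "mallows_mean q (insert x S) F =
    (\<Sum>r\<le>card S. q ^ (card S - r) * g r) / q_number q (card S + 1) * mallows_mean q S F"
proof -
  have x: "x \<notin> S" using S by auto
  have inv: "list_inversions (insert_at x r w) = (card S - r) + list_inversions w"
    if "w \<in> permutations_of_set S" "r \<le> card S" for w r
  proof -
    have "set w = S" "length w = card S" using that
      by (auto dest: permutations_of_setD length_finite_permutations_of_set)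
    then show ?thesis using that S list_inversions_insert_max[of "take r w" "drop r w" x]
      by (simp add: insert_at_def)
  qed
  have pow: "q ^ list_inversions (insert_at x r w) = q ^ (card S - r) * q ^ list_inversions w"
    if "w \<in> permutations_of_set S" "r \<le> card S" for w r
    by (simp only: inv[OF that] power_add)
  have "(\<Sum>w\<in>permutations_of_set (insert x S). q ^ list_inversions w * G w) =
      (\<Sum>r\<le>card S. q ^ (card S - r) * h r) * (\<Sum>w\<in>permutations_of_set S. q ^ list_inversions w * G w)"
    if "\<And>w r. w \<in> permutations_of_set S \<Longrightarrow> r \<le> card S \<Longrightarrow> G (insert_at x r w) = h r * G w" for G h
    unfolding sum_permutations_of_set_insert[OF S(1) x]
    by (subst sum_product, subst sum.swap, intro sum.cong refl)
      (simp add: pow that mult.assoc mult.left_commute)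
  from this[OF F] this[of "\<lambda>_. 1" "\<lambda>_. 1"]
  have "mallows_mean q (insert x S) F =
    (\<Sum>r\<le>card S. q ^ (card S - r) * g r) / (\<Sum>r\<le>card S. q ^ (card S - r)) * mallows_mean q S F"
    by (simp add: mallows_mean_def)
  then show ?thesis by (simp only: sum_atMost_diff)
qed

section \<open>The depth of a node of a binary search tree\<close>

text \<open>
  The smaller labels on the path from the root to the node labelled \<open>i\<close>. A label \<open>j < i\<close> lies on this
  path if and only if it comes first in \<open>w\<close> among all letters in the interval from \<open>j\<close> to \<open>i\<close>:
  if a letter strictly between them comes first, it sends \<open>i\<close> and \<open>j\<close> to different subtrees, and
  if \<open>i\<close> comes first, it is not a descendant of \<open>j\<close>. The condition depends only on the relative order of
  the letters of that interval, which makes it stable under insertion of letters outside of it.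
\<close>

definition low_ancestors :: "nat \<Rightarrow> nat list \<Rightarrow> nat set" where
  "low_ancestors i w = {j \<in> set w. j < i \<and> hd (filter (\<lambda>y. j \<le> y \<and> y \<le> i) w) = j}"

definition high_ancestors :: "nat \<Rightarrow> nat list \<Rightarrow> nat set" where
  "high_ancestors i w = {j \<in> set w. i < j \<and> hd (filter (\<lambda>y. i \<le> y \<and> y \<le> j) w) = j}"

lemma finite_ancestors [simp]: "finite (low_ancestors i w)" "finite (high_ancestors i w)"
  by (auto simp: low_ancestors_def high_ancestors_def)

definition node_depth :: "nat \<Rightarrow> nat list \<Rightarrow> nat" where
  "node_depth i w = card (low_ancestors i w) + card (high_ancestors i w)"

text \<open>
  If \<open>j\<close> and \<open>i\<close> lie on the same side of the root \<open>x\<close>, so does the whole interval between them, and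
  the filter that defines the subtree keeps all of its letters. If \<open>x\<close> separates them, then \<open>x\<close>
  itself comes first in the interval, so \<open>j\<close> is no ancestor of \<open>i\<close>.
\<close>

lemma low_ancestors_Cons:
  "low_ancestors i (x # w) =
    (if i < x then low_ancestors i (filter (\<lambda>y. y < x) w)
     else if x < i then insert x (low_ancestors i (filter (\<lambda>y. x < y) w)) else {})"
proof -
  have 1: "filter (\<lambda>y. j \<le> y \<and> y \<le> i) (filter (\<lambda>y. y < x) w) = filter (\<lambda>y. j \<le> y \<and> y \<le> i) w"
    if "i < x" for j using that by (auto intro!: filter_cong)
  have 2: "filter (\<lambda>y. j \<le> y \<and> y \<le> i) (filter (\<lambda>y. x < y) w) = filter (\<lambda>y. j \<le> y \<and> y \<le> i) w"
    if "x < j" for j using that by (auto intro!: filter_cong)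
  show ?thesis unfolding low_ancestors_def
    using 1 2 by (auto simp del: filter_filter split: if_splits)
qed

lemma high_ancestors_Cons:
  "high_ancestors i (x # w) =
    (if i < x then insert x (high_ancestors i (filter (\<lambda>y. y < x) w))
     else if x < i then high_ancestors i (filter (\<lambda>y. x < y) w) else {})"
proof -
  have 1: "filter (\<lambda>y. i \<le> y \<and> y \<le> j) (filter (\<lambda>y. x < y) w) = filter (\<lambda>y. i \<le> y \<and> y \<le> j) w"
    if "x < i" for j using that by (auto intro!: filter_cong)
  have 2: "filter (\<lambda>y. i \<le> y \<and> y \<le> j) (filter (\<lambda>y. y < x) w) = filter (\<lambda>y. i \<le> y \<and> y \<le> j) w"
    if "j < x" for j using that by (auto intro!: filter_cong)
  show ?thesis unfolding high_ancestors_def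
    using 1 2 by (auto simp del: filter_filter split: if_splits)
qed

lemma node_depth_Cons:
  "node_depth i (x # w) =
    (if i < x then Suc (node_depth i (filter (\<lambda>y. y < x) w))
     else if x < i then Suc (node_depth i (filter (\<lambda>y. x < y) w)) else 0)"
proof -
  have "x \<notin> low_ancestors i (filter (\<lambda>y. x < y) w)" "x \<notin> high_ancestors i (filter (\<lambda>y. y < x) w)"
    by (auto simp: low_ancestors_def high_ancestors_def)
  then show ?thesis
    by (auto simp: node_depth_def low_ancestors_Cons high_ancestors_Cons)
qed

lemma depths_bst:
  assumes "distinct w"
  shows "length ` bst w = (\<lambda>i. node_depth i w) ` set w"
  using assms
proof (induction w rule: bst.induct)
  case (2 x w)
  have pre: "length ` prepend [b] V = Suc ` length ` V" for b V
    by (force simp: prepend_def image_image)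
  have low: "Suc ` (\<lambda>i. node_depth i (filter (\<lambda>y. y < x) w)) ` {y \<in> set w. y < x} =
      (\<lambda>i. node_depth i (x # w)) ` {y \<in> set w. y < x}"
    unfolding image_image by (rule image_cong) (auto simp: node_depth_Cons)
  have high: "Suc ` (\<lambda>i. node_depth i (filter (\<lambda>y. y > x) w)) ` {y \<in> set w. y > x} =
      (\<lambda>i. node_depth i (x # w)) ` {y \<in> set w. y > x}"
    unfolding image_image by (rule image_cong) (auto simp: node_depth_Cons)
  have "set (x # w) = {x} \<union> {y \<in> set w. y < x} \<union> {y \<in> set w. y > x}"
    using 2 by auto
  moreover have "node_depth x (x # w) = 0" by (simp add: node_depth_Cons)
  ultimately show ?case using 2
    by (simp add: image_Un pre low high del: set_simps)
qed simp

lemma tree_height_bst: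
  assumes "distinct w" "w \<noteq> []"
  shows "tree_height (bst w) = real (Max ((\<lambda>i. node_depth i w) ` set w))"
proof -
  let ?D = "(\<lambda>i. node_depth i w) ` set w"
  have image: "(\<lambda>u. real (length u)) ` bst w = real ` ?D"
    using depths_bst[OF assms(1)] by (simp flip: image_image)
  have "[] \<in> bst w" using assms(2) by (cases w) auto
  then have "(INF u\<in>bst w. real (length u)) = 0"
    by (intro cInf_eq_minimum) force+
  moreover have "(SUP u\<in>bst w. real (length u)) = real (Max ?D)"
    unfolding image using assms(2) by (intro cSup_eq_maximum) auto
  ultimately show ?thesis by (simp add: tree_height_def)
qed

section \<open>Generating functions of the two numbers of ancestors\<close>

lemma set_insert_at [simp]: "set (insert_at x r w) = insert x (set w)"
  by (metis append_take_drop_id insert_at_def insert_is_Un list.simps(15) set_append sup_left_commute)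

lemma filter_insert_at_irrelevant: "\<not> P x \<Longrightarrow> filter P (insert_at x r w) = filter P w"
  by (simp add: insert_at_def) (metis append_take_drop_id filter_append)

lemma hd_insert_at:
  assumes "w \<noteq> []"
  shows "hd (insert_at x r w) = (if r = 0 then x else hd w)"
  using assms by (cases w; cases r) (auto simp: insert_at_def)

lemma low_ancestors_insert_larger:
  assumes "i < x"
  shows "low_ancestors i (insert_at x r w) = low_ancestors i w"
  using assms by (auto simp: low_ancestors_def filter_insert_at_irrelevant)

lemma high_ancestors_insert_smaller:
  assumes "x < i"
  shows "high_ancestors i (insert_at x r w) = high_ancestors i w"
  using assms by (auto simp: high_ancestors_def filter_insert_at_irrelevant)

text \<open>
  A new smallest letter \<open>x\<close> competes with all letters of \<open>w\<close> for the first place between \<open>x\<close> and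
  \<open>i\<close>, because \<open>i\<close> is the largest of them. Hence it is an ancestor of \<open>i\<close> if and only if it is put in
  front, and it is irrelevant for the ancestors above it.
\<close>

lemma low_ancestors_insert_min:
  assumes "i \<in> set w" and w: "\<And>y. y \<in> set w \<Longrightarrow> x < y \<and> y \<le> i"
  shows "low_ancestors i (insert_at x r w) = (if r = 0 then insert x (low_ancestors i w) else low_ancestors i w)"
proof -
  have "w \<noteq> []" using assms(1) by auto
  then have "hd w \<noteq> x" using w[of "hd w"] by auto
  have "filter (\<lambda>y. x \<le> y \<and> y \<le> i) (insert_at x r w) = insert_at x r w"
    using w[OF \<open>i \<in> set w\<close>] by (auto simp: filter_id_conv dest!: w)
  then have "hd (filter (\<lambda>y. x \<le> y \<and> y \<le> i) (insert_at x r w)) = x \<longleftrightarrow> r = 0"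
    using hd_insert_at[OF \<open>w \<noteq> []\<close>] \<open>hd w \<noteq> x\<close> by simp
  moreover have "hd (filter (\<lambda>y. j \<le> y \<and> y \<le> i) (insert_at x r w)) =
    hd (filter (\<lambda>y. j \<le> y \<and> y \<le> i) w)" if "j \<in> set w" for j
    using w[OF that] by (simp add: filter_insert_at_irrelevant)
  ultimately show ?thesis
    using w[OF \<open>i \<in> set w\<close>] by (auto simp: low_ancestors_def)
qed

lemma high_ancestors_insert_max:
  assumes "i \<in> set w" and w: "\<And>y. y \<in> set w \<Longrightarrow> y < x \<and> i \<le> y"
  shows "high_ancestors i (insert_at x r w) = (if r = 0 then insert x (high_ancestors i w) else high_ancestors i w)"
proof -
  have "w \<noteq> []" using assms(1) by auto
  then have "hd w \<noteq> x" using w[of "hd w"] by auto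
  have "filter (\<lambda>y. i \<le> y \<and> y \<le> x) (insert_at x r w) = insert_at x r w"
    using w[OF \<open>i \<in> set w\<close>] by (auto simp: filter_id_conv dest!: w)
  then have "hd (filter (\<lambda>y. i \<le> y \<and> y \<le> x) (insert_at x r w)) = x \<longleftrightarrow> r = 0"
    using hd_insert_at[OF \<open>w \<noteq> []\<close>] \<open>hd w \<noteq> x\<close> by simp
  moreover have "hd (filter (\<lambda>y. i \<le> y \<and> y \<le> j) (insert_at x r w)) =
    hd (filter (\<lambda>y. i \<le> y \<and> y \<le> j) w)" if "j \<in> set w" for j
    using w[OF that] by (simp add: filter_insert_at_irrelevant)
  ultimately show ?thesis
    using w[OF \<open>i \<in> set w\<close>] by (auto simp: high_ancestors_def)
qed

lemma q_number_ge_1: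
  assumes "0 \<le> q" "m \<ge> 1"
  shows "1 \<le> q_number q m"
proof -
  obtain k where "m = Suc k" using assms(2) by (cases m) auto
  then show ?thesis using assms(1) by (simp add: q_number_def sum.lessThan_Suc_shift sum_nonneg del: sum.lessThan_Suc)
qed

lemma mallows_mean_insert_min_invariant:
  assumes "0 \<le> q" "finite S" "\<And>y. y \<in> S \<Longrightarrow> x < y"
    and "\<And>w r. w \<in> permutations_of_set S \<Longrightarrow> F (insert_at x r w) = F w"
  shows "mallows_mean q (insert x S) F = mallows_mean q S F"
  using mallows_mean_insert_min[of S x F "\<lambda>_. 1" q] assms q_number_ge_1[of q "card S + 1"]
  by (simp add: q_number_def lessThan_Suc_atMost)

lemma mallows_mean_insert_max_invariant:
  assumes "0 \<le> q" "finite S" "\<And>y. y \<in> S \<Longrightarrow> y < x"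
    and "\<And>w r. w \<in> permutations_of_set S \<Longrightarrow> F (insert_at x r w) = F w"
  shows "mallows_mean q (insert x S) F = mallows_mean q S F"
  using mallows_mean_insert_max[of S x F "\<lambda>_. 1" q] assms q_number_ge_1[of q "card S + 1"]
  by (simp add: sum_atMost_diff)

text \<open>
  Inserting \<open>i - 1\<close>, \<open>i - 2\<close>, \<dots> into the word \<open>[i]\<close> one after the other creates a low ancestor
  in each step independently, in the step to length \<open>m\<close> with probability \<open>1 / q_number q m\<close>: this is the
  share of the position without inversions.
\<close>

lemma mallows_mean_low_ancestors_top:
  assumes q: "0 \<le> q"
  shows "k \<le> i \<Longrightarrow> mallows_mean q {i - k..i} (\<lambda>w. z ^ card (low_ancestors i w)) =
    (\<Prod>m=2..k + 1. 1 + (z - 1) / q_number q m)"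
proof (induction k)
  case 0
  have "low_ancestors i [i] = {}" by (auto simp: low_ancestors_def)
  then show ?case by (simp add: mallows_mean_def)
next
  case (Suc k)
  let ?S = "{i - k..i}" and ?x = "i - Suc k"
  have S: "{i - Suc k..i} = insert ?x ?S" "card ?S = k + 1" using Suc.prems by auto
  have "mallows_mean q (insert ?x ?S) (\<lambda>w. z ^ card (low_ancestors i w)) =
    (\<Sum>r\<le>card ?S. q ^ r * (if r = 0 then z else 1)) / q_number q (card ?S + 1) *
    mallows_mean q ?S (\<lambda>w. z ^ card (low_ancestors i w))"
  proof (rule mallows_mean_insert_min)
    fix w r assume w: "w \<in> permutations_of_set ?S"
    then have s: "set w = ?S" by (rule permutations_of_setD)
    then have "?x \<notin> low_ancestors i w" using Suc.prems by (auto simp: low_ancestors_def)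
    moreover have "low_ancestors i (insert_at ?x r w) =
        (if r = 0 then insert ?x (low_ancestors i w) else low_ancestors i w)"
      by (rule low_ancestors_insert_min) (use s Suc.prems in auto)
    ultimately show "z ^ card (low_ancestors i (insert_at ?x r w)) =
        (if r = 0 then z else 1) * z ^ card (low_ancestors i w)"
      by simp
  qed (use Suc.prems in auto)
  also have "(\<Sum>r\<le>card ?S. q ^ r * (if r = 0 then z else 1)) =
      (\<Sum>r\<le>card ?S. q ^ r + (if r = 0 then z - 1 else 0))"
    by (intro sum.cong) auto
  also have "\<dots> = q_number q (card ?S + 1) + (z - 1)"
    by (simp add: sum.distrib q_number_def lessThan_Suc_atMost)
  also have "\<dots> / q_number q (card ?S + 1) = 1 + (z - 1) / q_number q (card ?S + 1)"
    using q_number_ge_1[OF q, of "card ?S + 1"] by (simp add: add_divide_distrib)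
  finally show ?case
    using Suc.IH Suc.prems S by (simp add: mult.commute)
qed

text \<open>
  Here \<open>i + 1\<close>, \<open>i + 2\<close>, \<dots> are inserted, and the front position now creates the largest number
  \<open>m - 1\<close> of inversions. This is the source of the additional factor \<open>q ^ (m - 1)\<close>, which makes high
  ancestors rare.
\<close>

lemma mallows_mean_high_ancestors_bottom:
  assumes q: "0 \<le> q"
  shows "mallows_mean q {i..i + k} (\<lambda>w. z ^ card (high_ancestors i w)) =
    (\<Prod>m=2..k + 1. 1 + (z - 1) * q ^ (m - 1) / q_number q m)"
proof (induction k)
  case 0
  have "high_ancestors i [i] = {}" by (auto simp: high_ancestors_def)
  then show ?case by (simp add: mallows_mean_def)
next
  case (Suc k)
  let ?S = "{i..i + k}" and ?x = "i + Suc k"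
  have S: "{i..i + Suc k} = insert ?x ?S" "card ?S = k + 1" by auto
  have "mallows_mean q (insert ?x ?S) (\<lambda>w. z ^ card (high_ancestors i w)) =
    (\<Sum>r\<le>card ?S. q ^ (card ?S - r) * (if r = 0 then z else 1)) / q_number q (card ?S + 1) *
    mallows_mean q ?S (\<lambda>w. z ^ card (high_ancestors i w))"
  proof (rule mallows_mean_insert_max)
    fix w r assume w: "w \<in> permutations_of_set ?S"
    then have s: "set w = ?S" by (rule permutations_of_setD)
    then have "?x \<notin> high_ancestors i w" by (auto simp: high_ancestors_def)
    moreover have "high_ancestors i (insert_at ?x r w) =
        (if r = 0 then insert ?x (high_ancestors i w) else high_ancestors i w)"
      by (rule high_ancestors_insert_max) (use s in auto)
    ultimately show "z ^ card (high_ancestors i (insert_at ?x r w)) =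
        (if r = 0 then z else 1) * z ^ card (high_ancestors i w)"
      by simp
  qed auto
  also have "(\<Sum>r\<le>card ?S. q ^ (card ?S - r) * (if r = 0 then z else 1)) =
      (\<Sum>r\<le>card ?S. q ^ (card ?S - r) + (if r = 0 then (z - 1) * q ^ card ?S else 0))"
    by (intro sum.cong) (auto simp: algebra_simps)
  also have "\<dots> = q_number q (card ?S + 1) + (z - 1) * q ^ card ?S"
    by (simp only: sum.distrib sum_atMost_diff) simp
  also have "\<dots> / q_number q (card ?S + 1) = 1 + (z - 1) * q ^ card ?S / q_number q (card ?S + 1)"
    using q_number_ge_1[OF q, of "card ?S + 1"] by (simp add: add_divide_distrib)
  finally show ?case
    using Suc.IH S by (simp add: mult.commute)
qed

text \<open>
  Letters above \<open>i\<close> do not influence the low ancestors of \<open>i\<close>, so they can be added at the end.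
\<close>

lemma mallows_mean_low_ancestors:
  assumes q: "0 \<le> q" and i: "1 \<le> i" "i \<le> n"
  shows "mallows_mean q {1..n} (\<lambda>w. z ^ card (low_ancestors i w)) =
    (\<Prod>m=2..i. 1 + (z - 1) / q_number q m)"
  using i(2)
proof (induction n rule: dec_induct)
  case base
  then show ?case using mallows_mean_low_ancestors_top[OF q, of "i - 1" i z] i(1) by simp
next
  case (step n)
  have "{1..Suc n} = insert (Suc n) {1..n}" by auto
  then show ?case using step i
    by (simp, subst mallows_mean_insert_max_invariant[OF q]) (auto simp: low_ancestors_insert_larger)
qed

lemma mallows_mean_high_ancestors:
  assumes q: "0 \<le> q" and i: "1 \<le> i" "i \<le> n"
  shows "mallows_mean q {1..n} (\<lambda>w. z ^ card (high_ancestors i w)) =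
    (\<Prod>m=2..n - i + 1. 1 + (z - 1) * q ^ (m - 1) / q_number q m)"
proof -
  have "mallows_mean q {i - k..n} (\<lambda>w. z ^ card (high_ancestors i w)) =
    (\<Prod>m=2..n - i + 1. 1 + (z - 1) * q ^ (m - 1) / q_number q m)" if "k < i" for k
    using that
  proof (induction k)
    case 0
    then show ?case using mallows_mean_high_ancestors_bottom[OF q, of i "n - i" z] i by simp
  next
    case (Suc k)
    have "{i - Suc k..n} = insert (i - Suc k) {i - k..n}" using Suc.prems i by auto
    moreover have "mallows_mean q (insert (i - Suc k) {i - k..n}) (\<lambda>w. z ^ card (high_ancestors i w)) =
        mallows_mean q {i - k..n} (\<lambda>w. z ^ card (high_ancestors i w))"
      by (rule mallows_mean_insert_min_invariant[OF q])
        (use Suc.prems in \<open>auto simp: high_ancestors_insert_smaller\<close>)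
    ultimately show ?case using Suc by simp
  qed
  from this[of "i - 1"] i show ?thesis by simp
qed

section \<open>Exponential moments\<close>

text \<open>
  Summed over \<open>m\<close>, the first and the third bound compare the mean number of low ancestors with
  \<open>n * (1 - q)\<close> from below (for the label \<open>n\<close>) and, up to \<open>ln n\<close>, from above; the second bounds the
  mean number of high ancestors by \<open>ln n\<close>. The last two rest on the fact that each of
  the \<open>m\<close> terms of \<open>q_number q m\<close> is at least \<open>q ^ (m - 1)\<close>.
\<close>

lemma q_number_bounds:
  assumes q: "0 \<le> q" "q \<le> 1" and m: "m \<ge> 1"
  shows "1 - q \<le> 1 / q_number q m" "q ^ (m - 1) / q_number q m \<le> 1 / m"
    "1 / q_number q m \<le> (1 - q) + 1 / m"
proof -
  note pos = q_number_ge_1[OF q(1) m]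
  have geo: "(1 - q) * q_number q m = 1 - q ^ m"
    by (simp add: q_number_def one_diff_power_eq)
  show "1 - q \<le> 1 / q_number q m"
    using geo pos q by (simp add: pos_le_divide_eq)
  have "of_nat (card {..<m}) * q ^ (m - 1) \<le> q_number q m"
    unfolding q_number_def by (rule sum_bounded_below) (use q in \<open>auto intro!: power_decreasing\<close>)
  then have *: "m * q ^ (m - 1) \<le> q_number q m" by simp
  then show "q ^ (m - 1) / q_number q m \<le> 1 / m"
    using pos m by (simp add: field_simps)
  have "m * q ^ m \<le> m * q ^ (m - 1)"
    using q by (intro mult_left_mono power_decreasing) auto
  with * have "m * q ^ m \<le> q_number q m" by (rule order_trans[rotated])
  then have "q ^ m \<le> q_number q m / m"
    using m by (simp add: field_simps)
  then have "1 \<le> ((1 - q) + 1 / m) * q_number q m"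
    using geo by (simp add: distrib_right)
  then show "1 / q_number q m \<le> (1 - q) + 1 / m"
    using pos by (simp add: pos_divide_le_eq)
qed

lemma sum_inverse_le_ln:
  assumes "n \<ge> 1"
  shows "(\<Sum>m=2..n. 1 / real m) \<le> ln (real n)"
  using assms
proof (induction n rule: dec_induct)
  case (step n)
  have "1 / real (Suc n) \<le> ln (real (Suc n) / real n)"
    using ln_add1_ge[of "1 / real n"] step by (simp add: field_simps)
  also have "\<dots> = ln (real (Suc n)) - ln (real n)"
    using step by (intro ln_divide_pos) auto
  finally have "1 / real (Suc n) \<le> ln (real (Suc n)) - ln (real n)" .
  then show ?case using step by simp
qed simp

lemma prod_le_exp_sum:
  fixes a :: "'a \<Rightarrow> real"
  assumes "\<And>m. m \<in> I \<Longrightarrow> 0 \<le> 1 + a m" "\<And>m. m \<in> I \<Longrightarrow> a m \<le> b m"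
  shows "(\<Prod>m\<in>I. 1 + a m) \<le> exp (\<Sum>m\<in>I. b m)"
proof (cases "finite I")
  case True
  have "(\<Prod>m\<in>I. 1 + a m) \<le> (\<Prod>m\<in>I. exp (b m))"
    using assms by (intro prod_mono) (meson exp_ge_add_one_self exp_le_cancel_iff order_trans)
  then show ?thesis using True by (simp add: exp_sum)
qed simp

lemma mallows_mean_low_ancestors_le:
  assumes q: "0 \<le> q" "q \<le> 1" and i: "1 \<le> i" "i \<le> n" and z: "1 \<le> z"
  shows "mallows_mean q {1..n} (\<lambda>w. z ^ card (low_ancestors i w)) \<le>
    exp ((z - 1) * (n * (1 - q) + ln n))"
proof -
  have "mallows_mean q {1..n} (\<lambda>w. z ^ card (low_ancestors i w)) \<le>
      exp (\<Sum>m=2..i. (z - 1) * ((1 - q) + 1 / m))"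
    unfolding mallows_mean_low_ancestors[OF q(1) i]
  proof (rule prod_le_exp_sum)
    fix m assume m: "m \<in> {2..i}"
    then show "0 \<le> 1 + (z - 1) / q_number q m"
      using q_number_ge_1[of q m] q z by simp
    have "(z - 1) * (1 / q_number q m) \<le> (z - 1) * ((1 - q) + 1 / m)"
      using m q z by (intro mult_left_mono q_number_bounds) auto
    then show "(z - 1) / q_number q m \<le> (z - 1) * ((1 - q) + 1 / m)" by simp
  qed
  also have "(\<Sum>m=2..i. (z - 1) * ((1 - q) + 1 / m)) =
      (z - 1) * ((i - 1) * (1 - q) + (\<Sum>m=2..i. 1 / real m))"
    using i by (simp add: sum.distrib flip: sum_distrib_left)
  also have "\<dots> \<le> (z - 1) * (n * (1 - q) + ln n)"
  proof (intro mult_left_mono add_mono mult_right_mono)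
    show "(\<Sum>m=2..i. 1 / real m) \<le> ln n"
      using sum_inverse_le_ln[of i] i by (smt (verit) ln_le_cancel_iff of_nat_le_iff of_nat_0_less_iff le_trans less_eq_Suc_le One_nat_def)
  qed (use i q z in auto)
  finally show ?thesis by simp
qed

lemma mallows_mean_high_ancestors_le:
  assumes q: "0 \<le> q" "q \<le> 1" and i: "1 \<le> i" "i \<le> n" and z: "1 \<le> z"
  shows "mallows_mean q {1..n} (\<lambda>w. z ^ card (high_ancestors i w)) \<le> exp ((z - 1) * ln n)"
proof -
  let ?N = "n - i + 1"
  have "mallows_mean q {1..n} (\<lambda>w. z ^ card (high_ancestors i w)) \<le>
      exp (\<Sum>m=2..?N. (z - 1) * (1 / m))"
    unfolding mallows_mean_high_ancestors[OF q(1) i]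
  proof (rule prod_le_exp_sum)
    fix m assume m: "m \<in> {2..?N}"
    then show "0 \<le> 1 + (z - 1) * q ^ (m - 1) / q_number q m"
      using q_number_ge_1[of q m] q z by simp
    have "(z - 1) * (q ^ (m - 1) / q_number q m) \<le> (z - 1) * (1 / m)"
      using m q z by (intro mult_left_mono q_number_bounds) auto
    then show "(z - 1) * q ^ (m - 1) / q_number q m \<le> (z - 1) * (1 / m)" by simp
  qed
  also have "(\<Sum>m=2..?N. (z - 1) * (1 / m)) = (z - 1) * (\<Sum>m=2..?N. 1 / real m)"
    by (simp only: sum_distrib_left)
  also have "\<dots> \<le> (z - 1) * ln n"
  proof (intro mult_left_mono)
    have "(\<Sum>m=2..?N. 1 / real m) \<le> ln ?N" by (rule sum_inverse_le_ln) simp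
    also have "\<dots> \<le> ln n" using i by simp
    finally show "(\<Sum>m=2..?N. 1 / real m) \<le> ln n" .
  qed (use z in auto)
  finally show ?thesis by simp
qed

text \<open>
  The largest label \<open>n\<close> ends the rightmost path; for it every factor of the product is available, which
  gives the lower bound on the number of low ancestors in the form needed for a Chernoff bound.
\<close>

lemma mallows_mean_low_ancestors_max_le:
  assumes q: "0 \<le> q" "q \<le> 1" and n: "1 \<le> n" and z: "0 \<le> z" "z \<le> 1"
  shows "mallows_mean q {1..n} (\<lambda>w. z ^ card (low_ancestors n w)) \<le>
    exp (- ((1 - z) * (n - 1) * (1 - q)))"
proof -
  have "mallows_mean q {1..n} (\<lambda>w. z ^ card (low_ancestors n w)) \<le>
      exp (\<Sum>m=2..n. (z - 1) * (1 - q))"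
    unfolding mallows_mean_low_ancestors[OF q(1) n order_refl]
  proof (rule prod_le_exp_sum)
    fix m assume m: "m \<in> {2..n}"
    then show "0 \<le> 1 + (z - 1) / q_number q m"
      using q_number_ge_1[of q m] q z by (simp add: field_simps)
    have "(1 - z) * (1 - q) \<le> (1 - z) * (1 / q_number q m)"
      using m q z by (intro mult_left_mono q_number_bounds) auto
    then show "(z - 1) / q_number q m \<le> (z - 1) * (1 - q)"
      by (simp add: diff_divide_distrib algebra_simps)
  qed
  also have "(\<Sum>m=2..n. (z - 1) * (1 - q)) = - ((1 - z) * (n - 1) * (1 - q))"
    using n by (simp add: algebra_simps)
  finally show ?thesis by simp
qed

section \<open>Tail bounds for the height\<close>

lemma bij_betw_permutes_permutations_of_set:
  "bij_betw (\<lambda>\<sigma>. map \<sigma> [1..<n + 1]) {\<sigma>. \<sigma> permutes {1..n}} (permutations_of_set {1..n})"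
proof -
  let ?f = "\<lambda>\<sigma> :: nat \<Rightarrow> nat. map \<sigma> [1..<n + 1]"
  have inj: "inj_on ?f {\<sigma>. \<sigma> permutes {1..n}}"
  proof (rule inj_onI)
    fix \<sigma> \<tau> :: "nat \<Rightarrow> nat"
    assume p: "\<sigma> \<in> {\<sigma>. \<sigma> permutes {1..n}}" "\<tau> \<in> {\<sigma>. \<sigma> permutes {1..n}}" and "?f \<sigma> = ?f \<tau>"
    then have "\<forall>i\<in>set [1..<n + 1]. \<sigma> i = \<tau> i" by (simp only: map_eq_conv)
    moreover have "set [1..<n + 1] = {1..n}" by auto
    ultimately have "\<forall>i\<in>{1..n}. \<sigma> i = \<tau> i" by metis
    then show "\<sigma> = \<tau>" using p by (auto simp: fun_eq_iff permutes_def)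
  qed
  have "?f \<sigma> \<in> permutations_of_set {1..n}" if "\<sigma> permutes {1..n}" for \<sigma>
  proof
    have set: "set [1..<n + 1] = {1..n}" by auto
    show "set (?f \<sigma>) = {1..n}" using permutes_image[OF that] by (simp only: set_map set)
    show "distinct (?f \<sigma>)" using permutes_inj_on[OF that] by (simp only: distinct_map distinct_upt)
  qed
  then have "?f ` {\<sigma>. \<sigma> permutes {1..n}} \<subseteq> permutations_of_set {1..n}" by auto
  moreover have "card (?f ` {\<sigma>. \<sigma> permutes {1..n}}) = card (permutations_of_set {1..n})"
    using card_permutations[OF refl finite_atLeastAtMost, of 1 n]
    by (simp only: card_image[OF inj] card_permutations_of_set[OF finite_atLeastAtMost])
  ultimately have "?f ` {\<sigma>. \<sigma> permutes {1..n}} = permutations_of_set {1..n}"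
    by (intro card_subset_eq) auto
  with inj show ?thesis by (simp add: bij_betw_def)
qed

lemma prob_mallows_tree:
  assumes q: "0 \<le> q"
  shows "measure_pmf.prob (mallows_tree n q) A = mallows_mean q {1..n} (\<lambda>w. indicator A (bst w))"
proof -
  let ?P = "{\<sigma>. \<sigma> permutes {1..n}}" and ?W = "permutations_of_set {1..n}"
  let ?f = "\<lambda>\<sigma>. map \<sigma> [1..<n + 1]"
  have reindex: "(\<Sum>\<sigma>\<in>?P. q ^ inversions n \<sigma> * G (?f \<sigma>)) = (\<Sum>w\<in>?W. q ^ list_inversions w * G w)" for G
    using sum.reindex_bij_betw[OF bij_betw_permutes_permutations_of_set, of "\<lambda>w. q ^ list_inversions w * G w" n]
    by (simp only: inversions_eq_list_inversions)
  have "measure_pmf.prob (mallows_tree n q) A =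
      measure_pmf.expectation (mallows n q) (indicator ((\<lambda>\<sigma>. bst (?f \<sigma>)) -` A))"
    by (simp add: mallows_tree_def)
  also have "\<dots> = (\<Sum>\<sigma>\<in>?P. indicator ((\<lambda>\<sigma>. bst (?f \<sigma>)) -` A) \<sigma> * pmf (mallows n q) \<sigma>)"
    by (rule integral_measure_pmf_real)
      (auto simp: finite_permutations set_pmf_eq pmf_mallows[OF q] split: if_splits)
  also have "\<dots> = (\<Sum>\<sigma>\<in>?P. q ^ inversions n \<sigma> * indicator A (bst (?f \<sigma>))) / mallows_normalizer n q"
    unfolding sum_divide_distrib
    by (intro sum.cong) (auto simp: pmf_mallows[OF q] indicator_def simp del: upt_Suc)
  also have "\<dots> = mallows_mean q {1..n} (\<lambda>w. indicator A (bst w))"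
    unfolding mallows_mean_def mallows_normalizer_def
    using reindex[of "\<lambda>w. indicator A (bst w)"] reindex[of "\<lambda>_. 1"] by simp
  finally show ?thesis .
qed

lemma mallows_mean_mono:
  assumes "0 \<le> q" "\<And>w. w \<in> permutations_of_set S \<Longrightarrow> F w \<le> G w"
  shows "mallows_mean q S F \<le> mallows_mean q S G"
  unfolding mallows_mean_def using assms
  by (intro divide_right_mono sum_mono mult_left_mono sum_nonneg) auto

lemma mallows_mean_add: "mallows_mean q S (\<lambda>w. F w + G w) = mallows_mean q S F + mallows_mean q S G"
  by (simp add: mallows_mean_def distrib_left sum.distrib add_divide_distrib)

lemma mallows_mean_mult_right: "mallows_mean q S (\<lambda>w. F w * c) = mallows_mean q S F * c"
  by (simp add: mallows_mean_def sum_distrib_right mult.assoc)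

lemma mallows_mean_sum: "mallows_mean q S (\<lambda>w. \<Sum>i\<in>I. F i w) = (\<Sum>i\<in>I. mallows_mean q S (F i))"
  unfolding mallows_mean_def sum_distrib_left
  by (subst sum.swap) (simp add: sum_divide_distrib)

text \<open>
  The pointwise inequality behind the Chernoff bounds. The hypothesis has the factor \<open>ln z\<close> on both
  sides so that it serves for \<open>a \<le> k\<close> with \<open>z > 1\<close> as well as for \<open>k \<le> a\<close> with \<open>z < 1\<close>.
\<close>

lemma one_le_power_mult_exp:
  fixes z :: real
  assumes "0 < z" "a * ln z \<le> real k * ln z"
  shows "1 \<le> z ^ k * exp (- (a * ln z))"
proof -
  have "z ^ k = exp (real k * ln z)" using assms(1) by (simp add: exp_of_nat_mult)
  then show ?thesis using assms(2) by (simp flip: exp_add)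
qed

text \<open>
  A node deeper than \<open>(1 + 2 * \<delta>) * x\<close> has more than \<open>(1 + \<delta>) * x\<close> low ancestors or more than
  \<open>\<delta> * x\<close> high ones, so the dependence between the two numbers does not matter. Both events are
  treated by a Chernoff bound with parameter \<open>z = 1 + \<delta>\<close>, the optimal one for a Poisson variable
  with mean \<open>x\<close>, and the union over the \<open>n\<close> labels costs the factor \<open>n\<close>. The exponent for the high
  ancestors is at least as good, and it is weakened to that for the low ones.
\<close>

lemma mallows_height_upper_tail:
  fixes q \<delta> :: real
  assumes q: "0 \<le> q" "q \<le> 1" and n: "1 \<le> n" and \<delta>: "0 < \<delta>"
  shows "measure_pmf.prob (mallows_tree n q) {T. (1 + 2 * \<delta>) * (n * (1 - q)) < tree_height T} \<le>
    2 * real n * exp (\<delta> * ln n - ((1 + \<delta>) * ln (1 + \<delta>) - \<delta>) * (n * (1 - q)))" (is "?p \<le> _")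
proof -
  define x where "x = n * (1 - q)"
  define a b where "a = exp (- ((1 + \<delta>) * x * ln (1 + \<delta>)))" and "b = exp (- (\<delta> * x * ln (1 + \<delta>)))"
  let ?z = "1 + \<delta>" and ?c = "(1 + \<delta>) * ln (1 + \<delta>) - \<delta>"
  let ?low = "\<lambda>i w. ?z ^ card (low_ancestors i w)" and ?high = "\<lambda>i w. ?z ^ card (high_ancestors i w)"
  have "x \<ge> 0" using q by (simp add: x_def)
  have ln_pos: "ln ?z > 0" using \<delta> by simp
  have nonneg: "0 \<le> ?low i w * a" "0 \<le> ?high i w * b" for i w
    using \<delta> by (simp_all add: a_def b_def)
  have "?p \<le> mallows_mean q {1..n} (\<lambda>w. \<Sum>i=1..n. ?low i w * a + ?high i w * b)"
    unfolding prob_mallows_tree[OF q(1)] x_def[symmetric]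
  proof (rule mallows_mean_mono[OF q(1)])
    fix w assume "w \<in> permutations_of_set {1..n}"
    then have w: "distinct w" "set w = {1..n}" by (auto dest: permutations_of_setD)
    have "1 \<le> (\<Sum>i=1..n. ?low i w * a + ?high i w * b)" if high: "(1 + 2 * \<delta>) * x < tree_height (bst w)"
    proof -
      have "w \<noteq> []" using w n by auto
      have "Max ((\<lambda>i. node_depth i w) ` set w) \<in> (\<lambda>i. node_depth i w) ` set w"
        using \<open>w \<noteq> []\<close> by (intro Max_in) auto
      with high w \<open>w \<noteq> []\<close> obtain i where i: "i \<in> {1..n}" "(1 + 2 * \<delta>) * x < node_depth i w"
        by (auto simp: tree_height_bst)
      have "(1 + \<delta>) * x \<le> card (low_ancestors i w) \<or> \<delta> * x \<le> card (high_ancestors i w)"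
        using i(2) by (auto simp: node_depth_def algebra_simps)
      then have "1 \<le> ?low i w * a \<or> 1 \<le> ?high i w * b"
        unfolding a_def b_def using \<delta> ln_pos
        by (elim disj_forward) (intro one_le_power_mult_exp mult_right_mono; simp)+
      then have "1 \<le> ?low i w * a + ?high i w * b"
        using nonneg[of i w] by linarith
      also have "\<dots> \<le> (\<Sum>i=1..n. ?low i w * a + ?high i w * b)"
        using i nonneg by (intro member_le_sum) (auto intro: add_nonneg_nonneg)
      finally show ?thesis .
    qed
    then show "indicator {T. (1 + 2 * \<delta>) * x < tree_height T} (bst w) \<le>
        (\<Sum>i=1..n. ?low i w * a + ?high i w * b)"
      using nonneg by (auto simp: indicator_def intro!: sum_nonneg add_nonneg_nonneg)
  qed
  also have "\<dots> = (\<Sum>i=1..n. mallows_mean q {1..n} (?low i) * a + mallows_mean q {1..n} (?high i) * b)"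
    by (simp only: mallows_mean_sum mallows_mean_add mallows_mean_mult_right)
  also have "\<dots> \<le> (\<Sum>i=1..n. exp (\<delta> * ln n - ?c * x) + exp (\<delta> * ln n - ?c * x))"
  proof (intro sum_mono add_mono)
    fix i assume i: "i \<in> {1..n}"
    have "mallows_mean q {1..n} (?low i) * a \<le> exp (\<delta> * (x + ln n)) * a"
      using mallows_mean_low_ancestors_le[OF q, of i n ?z] i \<delta>
      by (intro mult_right_mono) (auto simp: x_def a_def)
    also have "\<dots> = exp (\<delta> * ln n - ?c * x)"
      by (simp add: a_def algebra_simps flip: exp_add)
    finally show "mallows_mean q {1..n} (?low i) * a \<le> exp (\<delta> * ln n - ?c * x)" .
    have "mallows_mean q {1..n} (?high i) * b \<le> exp (\<delta> * ln n) * b"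
      using mallows_mean_high_ancestors_le[OF q, of i n ?z] i \<delta>
      by (intro mult_right_mono) (auto simp: b_def)
    also have "\<dots> = exp (\<delta> * ln n - \<delta> * ln ?z * x)"
      by (simp add: b_def algebra_simps flip: exp_add)
    also have "\<dots> \<le> exp (\<delta> * ln n - ?c * x)"
    proof -
      have "?c \<le> \<delta> * ln ?z" using ln_add_one_self_le_self[of \<delta>] \<delta> by (simp add: algebra_simps)
      then show ?thesis using \<open>x \<ge> 0\<close> by (simp add: mult_right_mono)
    qed
    finally show "mallows_mean q {1..n} (?high i) * b \<le> exp (\<delta> * ln n - ?c * x)" .
  qed
  finally show ?thesis by (simp add: x_def)
qed

text \<open>
  It suffices to bound the length of the rightmost path, that is, the number of low ancestors of the
  label \<open>n\<close>. The term \<open>\<delta>\<close> in the exponent pays for the replacement of \<open>n - 1\<close> by \<open>n\<close>.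
\<close>

lemma mallows_height_lower_tail:
  fixes q \<delta> :: real
  assumes q: "0 \<le> q" "q \<le> 1" and n: "1 \<le> n" and \<delta>: "0 < \<delta>" "\<delta> < 1"
  shows "measure_pmf.prob (mallows_tree n q) {T. tree_height T < (1 - \<delta>) * (n * (1 - q))} \<le>
    exp (\<delta> - ((1 - \<delta>) * ln (1 - \<delta>) + \<delta>) * (n * (1 - q)))" (is "?p \<le> _")
proof -
  define x where "x = n * (1 - q)"
  define a where "a = exp (- ((1 - \<delta>) * x * ln (1 - \<delta>)))"
  let ?z = "1 - \<delta>"
  let ?low = "\<lambda>w. ?z ^ card (low_ancestors n w)"
  have nonneg: "0 \<le> ?low w * a" for w
    using \<delta> by (simp add: a_def)
  have "?p \<le> mallows_mean q {1..n} (\<lambda>w. ?low w * a)"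
    unfolding prob_mallows_tree[OF q(1)] x_def[symmetric]
  proof (rule mallows_mean_mono[OF q(1)])
    fix w assume "w \<in> permutations_of_set {1..n}"
    then have w: "distinct w" "set w = {1..n}" by (auto dest: permutations_of_setD)
    have "1 \<le> ?low w * a" if less: "tree_height (bst w) < ?z * x"
    proof -
      have "w \<noteq> []" using w n by auto
      have "node_depth n w \<le> Max ((\<lambda>i. node_depth i w) ` set w)"
        using w n by (intro Max_ge) auto
      with less w \<open>w \<noteq> []\<close> have "node_depth n w < ?z * x"
        by (auto simp: tree_height_bst)
      then have "card (low_ancestors n w) \<le> ?z * x"
        by (simp add: node_depth_def)
      then show ?thesis
        unfolding a_def using \<delta> by (intro one_le_power_mult_exp mult_right_mono_neg) auto
    qed
    then show "indicator {T. tree_height T < ?z * x} (bst w) \<le> ?low w * a"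
      using nonneg by (auto simp: indicator_def)
  qed
  also have "\<dots> = mallows_mean q {1..n} ?low * a"
    by (rule mallows_mean_mult_right)
  also have "\<dots> \<le> exp (- (\<delta> * (n - 1) * (1 - q))) * a"
    using mallows_mean_low_ancestors_max_le[OF q n, of ?z] \<delta>
    by (intro mult_right_mono) (auto simp: a_def)
  also have "\<dots> = exp (\<delta> * (1 - q) - (?z * ln ?z + \<delta>) * x)"
    using n by (simp add: a_def x_def of_nat_diff algebra_simps flip: exp_add)
  also have "\<dots> \<le> exp (\<delta> - (?z * ln ?z + \<delta>) * x)"
    using q \<delta> by (simp add: mult_left_le)
  finally show ?thesis by (simp only: x_def)
qed

text \<open>
  With \<open>x = 1 + \<delta>\<close> and \<open>x = 1 - \<delta>\<close> this says that the rates in the two tail bounds are positive.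
\<close>

lemma minus_one_less_mult_ln:
  fixes x :: real
  assumes "0 < x" "x \<noteq> 1"
  shows "x - 1 < x * ln x"
proof -
  have "ln 1 - ln x < (1 - x) / x" using assms by (intro ln_diff_less) auto
  then show ?thesis using assms by (simp add: field_simps)
qed

section \<open>Concentration of the height\<close>

theorem theorem1p2:
  fixes q :: "nat \<Rightarrow> real" and \<epsilon> lam :: real
  assumes "\<And>n. q n \<in> {0..1}"
    and "filterlim (\<lambda>n. real n * (1 - q n) / ln (real n)) at_top sequentially"
    and "\<epsilon> > 0" and "lam > 0"
  shows "(\<lambda>n. measure_pmf.prob (mallows_tree n (q n))
            {T. \<bar>tree_height T / (real n * (1 - q n)) - 1\<bar> > \<epsilon>})
         \<in> O(\<lambda>n. 1 / real n powr lam)"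
proof -
  define \<delta> where "\<delta> = min (\<epsilon> / 2) (1 / 2)"
  have \<delta>: "0 < \<delta>" "\<delta> < 1" "2 * \<delta> \<le> \<epsilon>" "\<delta> \<le> \<epsilon>" using assms(3) by (auto simp: \<delta>_def)
  define c where "c = min ((1 + \<delta>) * ln (1 + \<delta>) - \<delta>) ((1 - \<delta>) * ln (1 - \<delta>) + \<delta>)"
  have c: "c > 0" "c \<le> (1 + \<delta>) * ln (1 + \<delta>) - \<delta>" "c \<le> (1 - \<delta>) * ln (1 - \<delta>) + \<delta>"
    using minus_one_less_mult_ln[of "1 + \<delta>"] minus_one_less_mult_ln[of "1 - \<delta>"] \<delta> by (auto simp: c_def)
  \<comment> \<open>The value for which \<open>n * exp (\<delta> * ln n - c * x)\<close> is at most \<open>n powr - lam\<close> once \<open>x \<ge> K * ln n\<close>.\<close>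
  define K where "K = (lam + 1 + \<delta>) / c"
  have ev: "eventually (\<lambda>n. K \<le> real n * (1 - q n) / ln (real n)) sequentially"
    using assms(2) by (simp add: filterlim_at_top)
  show ?thesis
  proof (rule bigoI)
    show "eventually (\<lambda>n. norm (measure_pmf.prob (mallows_tree n (q n))
            {T. \<bar>tree_height T / (real n * (1 - q n)) - 1\<bar> > \<epsilon>})
         \<le> (2 + exp \<delta>) * norm (1 / real n powr lam)) sequentially"
      using ev eventually_ge_at_top[of "2 :: nat"]
    proof eventually_elim
      case (elim n)
      define x where "x = real n * (1 - q n)"
      have q: "0 \<le> q n" "q n \<le> 1" using assms(1)[of n] by auto
      have n: "1 \<le> n" "ln (real n) > 0" using elim by auto
      have "K * ln n \<le> x" using elim n by (simp add: x_def pos_le_divide_eq)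
      then have cx: "(lam + 1 + \<delta>) * ln n \<le> c * x"
        using c by (simp add: K_def pos_divide_le_eq mult.commute)
      have "0 < (lam + 1 + \<delta>) * ln n" using assms(4) \<delta> n by simp
      with cx have "0 < c * x" by linarith
      with c have "x > 0" by (simp add: zero_less_mult_iff)
      have "measure_pmf.prob (mallows_tree n (q n)) {T. \<bar>tree_height T / x - 1\<bar> > \<epsilon>} \<le>
        measure_pmf.prob (mallows_tree n (q n))
          ({T. (1 + 2 * \<delta>) * x < tree_height T} \<union> {T. tree_height T < (1 - \<delta>) * x})"
      proof (rule measure_pmf.finite_measure_mono)
        show "{T. \<bar>tree_height T / x - 1\<bar> > \<epsilon>} \<subseteq>
            {T. (1 + 2 * \<delta>) * x < tree_height T} \<union> {T. tree_height T < (1 - \<delta>) * x}"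
        proof
          fix T assume "T \<in> {T. \<bar>tree_height T / x - 1\<bar> > \<epsilon>}"
          then have "1 + 2 * \<delta> < tree_height T / x \<or> tree_height T / x < 1 - \<delta>"
            using \<delta> by auto
          then show "T \<in> {T. (1 + 2 * \<delta>) * x < tree_height T} \<union> {T. tree_height T < (1 - \<delta>) * x}"
            using \<open>x > 0\<close> by (simp add: pos_less_divide_eq pos_divide_less_eq)
        qed
      qed simp
      also have "\<dots> \<le> measure_pmf.prob (mallows_tree n (q n)) {T. (1 + 2 * \<delta>) * x < tree_height T} +
          measure_pmf.prob (mallows_tree n (q n)) {T. tree_height T < (1 - \<delta>) * x}"
        by (rule measure_Un_le) auto
      also have "\<dots> \<le> 2 * real n * exp (\<delta> * ln n - ((1 + \<delta>) * ln (1 + \<delta>) - \<delta>) * x) +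
          exp (\<delta> - ((1 - \<delta>) * ln (1 - \<delta>) + \<delta>) * x)"
        unfolding x_def
        by (rule add_mono[OF mallows_height_upper_tail[OF q n(1) \<delta>(1)]
              mallows_height_lower_tail[OF q n(1) \<delta>(1,2)]])
      also have "\<dots> \<le> 2 * real n * exp (\<delta> * ln n - c * x) + exp (\<delta> - c * x)"
        using c \<open>x > 0\<close> by (intro add_mono mult_left_mono) (auto simp: mult_right_mono)
      also have "2 * real n * exp (\<delta> * ln n - c * x) = 2 * exp ((1 + \<delta>) * ln n - c * x)"
        using n by (simp add: distrib_right exp_add exp_diff)
      also have "2 * exp ((1 + \<delta>) * ln n - c * x) + exp (\<delta> - c * x) \<le>
          2 * exp (- lam * ln n) + exp (\<delta> + - lam * ln n)"
        using cx \<delta> n by (intro add_mono mult_left_mono) (auto simp: algebra_simps intro: order_trans[OF _ cx])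
      also have "\<dots> = (2 + exp \<delta>) * (1 / real n powr lam)"
        using n by (simp add: exp_add exp_diff powr_def exp_minus field_simps)
      finally show ?case by (simp add: x_def)
    qed
  qed
qed

end
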